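(* Let $V$ be a real Euclidean vector space of dimension $n$, let $\Phi\subseteq V$ be a root system and let $\mathcal{W}\subseteq \operatorname{GL}(V)$ be the finite reflection group defined by $\Phi$. Let $\eta_1,\dots,\eta_n$ be homogeneous basic invariants of $\mathcal{W}$ of degrees $1\le d_1\le d_2\le\dots\le d_n$, and assume that $|x|^2$ belongs to the $\mathbb{R}$-algebra $\mathbb{R}[\eta_1,\dots,\eta_{n-1}]$ generated by the first $n-1$ of them. If $F$ is a $\mathcal{W}$-invariant homogeneous polynomial (form) on $V$ of degree $2d<2d_n$, then $F$ is nonnegative on $V$ if and only if $F$ is nonnegative on the set $\mathcal{H}_{\mathcal{W}}$, the union of the hyperplanes in $V$ perpendicular to the elements of $\Phi$.
   Context: A root system $\Phi\subseteq V$ is a finite set of vectors such that the only multiples of $v\in\Phi$ lying in $\Phi$ are $\pm v$, and $T_H(\Phi)\subseteq\Phi$ for the orthogonal reflection $T_H(w)=w-2\frac{\langle w,v\rangle}{\langle v,v\rangle}v$ across any hyperplane $H$ perpendicular to an element $v\in\Phi$. The reflection group $\mathcal{W}$ defined by $\Phi$ is the subgroup of $\operatorname{GL}(V)$ generated by these reflections. $\mathcal{W}$ acts on polynomial functions on $V$ by $(wf)(x)=f(w^{-1}x)$; by Chevalley's theorem the algebra of invariant polynomials is generated by $n$ algebraically independent homogeneous elements of positive degree, called basic invariants. $|x|^2=\langle x,x\rangle$. *)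

theory Defs
  imports
    "HOL-Analysis.Analysis"
    "HOL-Algebra.Generated_Groups"
    "HOL-Library.Poly_Mapping"
begin

definition reflection :: "'a::real_inner \<Rightarrow> 'a \<Rightarrow> 'a" where
  "reflection v w = w - (2 * ((w \<bullet> v) / (v \<bullet> v))) *\<^sub>R v"

(* Roots are nonzero, since each of them determines a hyperplane; they need not span the space. *)
definition root_system :: "'a::real_inner set \<Rightarrow> bool" where
  "root_system \<Phi> \<longleftrightarrow>
     finite \<Phi> \<and> 0 \<notin> \<Phi> \<and>
     (\<forall>v\<in>\<Phi>. {c *\<^sub>R v | c. True} \<inter> \<Phi> = {v, - v}) \<and>
     (\<forall>v\<in>\<Phi>. reflection v ` \<Phi> \<subseteq> \<Phi>)"

definition GL :: "('a::real_vector \<Rightarrow> 'a) monoid" where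
  "GL = \<lparr>carrier = {f. linear f \<and> bij f}, monoid.mult = (\<circ>), one = id\<rparr>"

lemma group_GL: "group (GL :: ('a::real_vector \<Rightarrow> 'a) monoid)"
proof (rule groupI)
  fix f :: "'a \<Rightarrow> 'a"
  assume "f \<in> carrier GL"
  then have f: "linear f" "bij f"
    by (auto simp: GL_def)
  then have "linear (inv_into UNIV f)"
    by (intro linearI)
      (auto intro!: inv_into_f_eq
        simp: linear_add linear_scale bij_is_inj bij_is_surj surj_f_inv_f)
  with f have "inv_into UNIV f \<in> carrier GL"
    by (simp add: GL_def bij_imp_bij_inv)
  moreover have "inv_into UNIV f \<otimes>\<^bsub>GL\<^esub> f = \<one>\<^bsub>GL\<^esub>"
    using f by (simp add: GL_def bij_is_inj)
  ultimately show "\<exists>g\<in>carrier GL. g \<otimes>\<^bsub>GL\<^esub> f = \<one>\<^bsub>GL\<^esub>" by blast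
qed (auto simp: GL_def comp_assoc bij_comp linear_compose linear_id)

definition reflection_group :: "'a::real_inner set \<Rightarrow> ('a \<Rightarrow> 'a) set" where
  "reflection_group \<Phi> = generate GL (reflection ` \<Phi>)"

definition hyperplane_union :: "'a::real_inner set \<Rightarrow> 'a set" where
  "hyperplane_union \<Phi> = (\<Union>v\<in>\<Phi>. {x. x \<bullet> v = 0})"

definition act :: "('a::real_vector \<Rightarrow> 'a) \<Rightarrow> ('a \<Rightarrow> real) \<Rightarrow> 'a \<Rightarrow> real" where
  "act w f x = f ((inv\<^bsub>GL\<^esub> w) x)"

definition invariant_under :: "('a::real_vector \<Rightarrow> 'a) set \<Rightarrow> ('a \<Rightarrow> real) \<Rightarrow> bool" where
  "invariant_under W f \<longleftrightarrow> (\<forall>w\<in>W. act w f = f)"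

(* The zero form is homogeneous of every degree. *)
definition form :: "nat \<Rightarrow> ('a::real_normed_vector \<Rightarrow> real) \<Rightarrow> bool" where
  "form k f \<longleftrightarrow> real_polynomial_function f \<and> (\<forall>c x. f (c *\<^sub>R x) = c ^ k * f x)"

inductive_set generated_algebra :: "('a \<Rightarrow> real) set \<Rightarrow> ('a \<Rightarrow> real) set" for S where
  const: "(\<lambda>x. c) \<in> generated_algebra S"
| gen: "f \<in> S \<Longrightarrow> f \<in> generated_algebra S"
| add: "f \<in> generated_algebra S \<Longrightarrow> g \<in> generated_algebra S \<Longrightarrow>
    (\<lambda>x. f x + g x) \<in> generated_algebra S"
| mult: "f \<in> generated_algebra S \<Longrightarrow> g \<in> generated_algebra S \<Longrightarrow>
    (\<lambda>x. f x * g x) \<in> generated_algebra S"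

(* A multivariate polynomial maps exponent vectors, which map variables to exponents,
   to coefficients. *)
definition eval_mpoly :: "(('i \<Rightarrow>\<^sub>0 nat) \<Rightarrow>\<^sub>0 real) \<Rightarrow> ('i \<Rightarrow> real) \<Rightarrow> real" where
  "eval_mpoly p y =
     (\<Sum>m\<in>Poly_Mapping.keys p.
        Poly_Mapping.lookup p m * (\<Prod>i\<in>Poly_Mapping.keys m. y i ^ Poly_Mapping.lookup m i))"

definition algebraically_independent :: "'i set \<Rightarrow> ('i \<Rightarrow> 'a \<Rightarrow> real) \<Rightarrow> bool" where
  "algebraically_independent I \<eta> \<longleftrightarrow>
     (\<forall>p. (\<forall>m\<in>Poly_Mapping.keys p. Poly_Mapping.keys m \<subseteq> I) \<longrightarrow>
        (\<forall>x. eval_mpoly p (\<lambda>i. \<eta> i x) = 0) \<longrightarrow> p = 0)"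

definition basic_invariants ::
    "('a::euclidean_space \<Rightarrow> 'a) set \<Rightarrow> (nat \<Rightarrow> 'a \<Rightarrow> real) \<Rightarrow> (nat \<Rightarrow> nat) \<Rightarrow> bool" where
  "basic_invariants W \<eta> deg \<longleftrightarrow>
     (\<forall>i\<in>{1..DIM('a)}. form (deg i) (\<eta> i) \<and> 1 \<le> deg i \<and> invariant_under W (\<eta> i)) \<and>
     algebraically_independent {1..DIM('a)} \<eta> \<and>
     generated_algebra (\<eta> ` {1..DIM('a)}) = {f. real_polynomial_function f \<and> invariant_under W f}"

end

theory Submission
  imports Defs "HOL-Computational_Algebra.Polynomial"
begin

text \<open>
  Since 2d < 2 deg n, the form F is affine in the last basic invariant: F = A + B eta_n with A and B
  in the algebra generated by the other invariants. On a common level set Y of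
  eta_1, ..., eta_(n-1) the functions A and B are constant, and Y is compact because the norm is
  constant on it, so F is minimised on Y at an extremum of eta_n. Such an extremum lies on a reflecting
  hyperplane: at a point off the hyperplanes the stabiliser is trivial, so eta is injective nearby
  because invariants separate orbits, and by invariance of domain eta is open there, so eta_n can be
  moved in both directions within Y. Invariance of domain thus replaces the usual formula for the
  Jacobian of eta.
\<close>

section \<open>Reflections and words of reflections\<close>

lemma linear_reflection: "linear (reflection v)"
  by (rule linearI) (simp_all add: reflection_def inner_add_left algebra_simps add_divide_distrib)

lemma reflection_zero [simp]: "reflection 0 = id"
  by (auto simp: reflection_def)

lemma reflection_self [simp]: "reflection v v = - v"
  by (cases "v = 0") (simp_all add: reflection_def scaleR_2)

lemma reflection_reflection [simp]: "reflection v (reflection v w) = w"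
  by (cases "v = 0") (simp_all add: reflection_def inner_diff_left algebra_simps)

lemma reflection_comp_reflection: "reflection v \<circ> reflection v = id"
  by auto

lemma inner_reflection_reflection: "reflection v a \<bullet> reflection v b = a \<bullet> b"
  by (cases "v = 0")
    (simp_all add: reflection_def inner_diff_left inner_diff_right inner_commute field_simps)

lemma orthogonal_transformation_reflection: "orthogonal_transformation (reflection v)"
  by (simp add: orthogonal_transformation_def linear_reflection inner_reflection_reflection)

text \<open>The conjugation rule g s_v g^-1 = s_(g v), in a form without inverses; \<open>g\<close>
  preserves the inner products that occur in the coefficient.\<close>

lemma reflection_conjugate:
  assumes "orthogonal_transformation g"
  shows "g (reflection v u) = reflection (g v) (g u)"
  using assms by (simp add: orthogonal_transformation_def reflection_def linear_diff linear_scale)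

lemma reflection_in_GL: "reflection v \<in> carrier GL"
  by (auto simp: GL_def linear_reflection
      intro: o_bij[OF reflection_comp_reflection reflection_comp_reflection])

lemma inv_reflection: "inv\<^bsub>GL\<^esub> (reflection v) = reflection v"
  by (rule group.inv_equality[OF group_GL])
    (simp_all add: reflection_in_GL, simp add: GL_def reflection_comp_reflection)

text \<open>Products are kept as lists so that their length is available for choosing shortest
  expressions.\<close>

primrec word :: "'a::real_inner list \<Rightarrow> 'a \<Rightarrow> 'a" where
  "word [] = id"
| "word (t # ts) = reflection t \<circ> word ts"

lemma word_append: "word (ts @ us) = word ts \<circ> word us"
  by (induction ts) (simp_all add: comp_assoc)

lemma word_rev: "word (rev ts) (word ts y) = y"
  by (induction ts arbitrary: y) (simp_all add: word_append)

lemma orthogonal_transformation_word: "orthogonal_transformation (word ts)"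
  by (induction ts)
    (simp_all add: id_def orthogonal_transformation_id orthogonal_transformation_compose
      orthogonal_transformation_reflection del: o_apply)

text \<open>Reflections are their own inverses, so inverses of generators give no further
  words.\<close>

lemma reflection_group_imp_word:
  assumes "w \<in> reflection_group \<Phi>"
  obtains ts where "set ts \<subseteq> \<Phi>" "w = word ts"
proof -
  have "\<exists>ts. set ts \<subseteq> \<Phi> \<and> w = word ts"
    using assms unfolding reflection_group_def
  proof (induction rule: generate.induct)
    case one
    then show ?case by (intro exI[of _ "[]"]) (simp add: GL_def)
  next
    case (incl h)
    then obtain v where "v \<in> \<Phi>" "h = reflection v" by blast
    then show ?case by (intro exI[of _ "[v]"]) simp
  next
    case (inv h)
    then obtain v where "v \<in> \<Phi>" "h = reflection v" by blast
    then show ?case by (intro exI[of _ "[v]"]) (simp add: inv_reflection)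
  next
    case (eng h1 h2)
    then obtain ts us where "set (ts @ us) \<subseteq> \<Phi>" "h1 = word ts" "h2 = word us" by auto
    then show ?case by (intro exI[of _ "ts @ us"]) (simp add: GL_def word_append)
  qed
  then show thesis using that by blast
qed

lemma reflection_root:
  "root_system \<Phi> \<Longrightarrow> v \<in> \<Phi> \<Longrightarrow> u \<in> \<Phi> \<Longrightarrow> reflection v u \<in> \<Phi>"
  unfolding root_system_def by blast

lemma word_root: "root_system \<Phi> \<Longrightarrow> set ts \<subseteq> \<Phi> \<Longrightarrow> u \<in> \<Phi> \<Longrightarrow> word ts u \<in> \<Phi>"
  by (induction ts) (simp_all add: reflection_root)

lemma subgroup_reflection_group: "subgroup (reflection_group \<Phi>) GL"
  unfolding reflection_group_def
  by (rule group.generate_is_subgroup[OF group_GL]) (auto simp: reflection_in_GL)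

lemma orthogonal_transformation_reflection_group:
  "w \<in> reflection_group \<Phi> \<Longrightarrow> orthogonal_transformation w"
  by (metis reflection_group_imp_word orthogonal_transformation_word)

section \<open>Stabilisers of regular points\<close>

text \<open>The point \<open>x\<close> lies in an open chamber, and pairing with it splits the roots
  into positive and negative ones; \<open>v \<bullet> x\<close> plays the role of the height of
  \<open>v\<close>.\<close>

locale regular_point =
  fixes \<Phi> :: "'a::real_inner set" and x :: 'a
  assumes root_system: "root_system \<Phi>"
    and regular: "v \<in> \<Phi> \<Longrightarrow> v \<bullet> x \<noteq> 0"
begin

section \<open>Positive and simple roots\<close>

definition pos :: "'a set" where "pos = {v \<in> \<Phi>. v \<bullet> x > 0}"

lemma finite_pos: "finite pos"
  using root_system by (simp add: pos_def root_system_def)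

lemma uminus_root: "v \<in> \<Phi> \<Longrightarrow> - v \<in> \<Phi>"
  using root_system unfolding root_system_def by (metis Int_iff insert_iff)

lemma root_not_pos: "v \<in> \<Phi> \<Longrightarrow> v \<notin> pos \<longleftrightarrow> - v \<in> pos"
  using regular[of v] by (auto simp: pos_def uminus_root)

lemma pos_multiple:
  assumes "v \<in> pos" "u \<in> pos" "u = c *\<^sub>R v"
  shows "u = v"
proof -
  have "u \<in> {c *\<^sub>R v | c. True} \<inter> \<Phi>" using assms by (auto simp: pos_def)
  then have "u \<in> {v, - v}"
    using root_system assms(1) unfolding root_system_def pos_def by blast
  moreover have "- v \<notin> pos" using assms(1) by (simp add: pos_def)
  ultimately show ?thesis using assms(2) by blast
qed

text \<open>Simple roots are described by the cone they span and by the action of their reflections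
  on positive roots, in place of linear independence.\<close>

definition simple_roots :: "'a set \<Rightarrow> bool" where
  "simple_roots T \<longleftrightarrow> T \<subseteq> pos \<and> pos \<subseteq> convex_cone hull T \<and>
     (\<forall>t\<in>T. \<forall>u\<in>pos - {t}. reflection t u \<in> pos)"

text \<open>A set of positive roots that is minimal among those spanning the cone of positive roots works.\<close>
lemma simple_roots_exist: "\<exists>T. simple_roots T"
proof -
  let ?Q = "\<lambda>T. T \<subseteq> pos \<and> pos \<subseteq> convex_cone hull T"
  have "?Q pos" by (simp add: hull_subset)
  then obtain T where T: "?Q T" and min: "\<And>S. ?Q S \<Longrightarrow> card T \<le> card S"
    using ex_has_least_nat[of ?Q pos card] by blast
  have "reflection b u \<in> pos" if b: "b \<in> T" and u: "u \<in> pos" "u \<noteq> b" for b u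
  proof (rule ccontr)
    assume notpos: "reflection b u \<notin> pos"
    have bpos: "b \<in> pos" using b T by blast
    define c where "c = 2 * ((u \<bullet> b) / (b \<bullet> b))"
    \<comment> \<open>If reflecting in \<open>b\<close> makes \<open>u\<close> negative, then
      \<open>u'\<close> is positive and \<open>u + u'\<close> is the multiple
      \<open>c *\<^sub>R b\<close>.\<close>
    define u' where "u' = - reflection b u"
    have u': "u' \<in> pos"
      using notpos root_not_pos reflection_root[OF root_system] u(1) bpos
      by (auto simp: u'_def pos_def)
    let ?K = "convex_cone hull (T - {b})"
    \<comment> \<open>The sum of the ray through \<open>b\<close> and the cone \<open>?K\<close>; it
      contains \<open>T\<close>, so every positive root splits off a nonnegative multiple of
      \<open>b\<close>.\<close>
    let ?L = "{a *\<^sub>R b + r | a r. a \<ge> 0 \<and> r \<in> ?K}"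
    have "convex_cone ?L"
    proof -
      have "?L = (\<Union>p\<in>{a *\<^sub>R b | a. a \<ge> 0}. \<Union>q\<in>?K. {p + q})" by blast
      moreover have "convex_cone {a *\<^sub>R b | a. a \<ge> 0}"
        by (auto simp: convex_cone_iff simp flip: scaleR_add_left intro: exI[of _ "0::real"])
      ultimately show ?thesis
        by (simp only: convex_cone_sums convex_cone_convex_cone_hull)
    qed
    moreover have "T \<subseteq> ?L"
    proof
      fix t assume t: "t \<in> T"
      show "t \<in> ?L"
      proof (cases "t = b")
        case True
        then show ?thesis
          by (auto intro!: exI[of _ "1::real"] exI[of _ "0::'a"] convex_cone_hull_contains_0)
      next
        case False
        then show ?thesis using t
          by (auto intro!: exI[of _ "0::real"] exI[of _ t] hull_inc)
      qed
    qed
    ultimately have "convex_cone hull T \<subseteq> ?L" by (simp add: hull_minimal)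
    then have posL: "pos \<subseteq> ?L" using T by blast
    obtain a r where ar: "u = a *\<^sub>R b + r" "a \<ge> 0" "r \<in> ?K" using posL u(1) by blast
    obtain a' r' where ar': "u' = a' *\<^sub>R b + r'" "a' \<ge> 0" "r' \<in> ?K" using posL u' by blast
    have "c *\<^sub>R b = u + u'" by (simp add: u'_def reflection_def c_def)
    then have eq: "(c - a - a') *\<^sub>R b = r + r'"
      using ar(1) ar'(1) by (simp add: algebra_simps)
    have rr'K: "r + r' \<in> ?K" using ar ar' convex_cone_hull_add by blast
    have bx: "b \<bullet> x > 0" using bpos by (simp add: pos_def)
    \<comment> \<open>Nonzero elements of \<open>?K\<close> pair strictly positively with
      \<open>x\<close>, so sums in \<open>?K\<close> cannot cancel.\<close>
    have K_pos: "?K \<subseteq> {q. q = 0 \<or> q \<bullet> x > 0}"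
    proof (rule hull_minimal)
      show "T - {b} \<subseteq> {q. q = 0 \<or> q \<bullet> x > 0}" using T by (auto simp: pos_def)
      show "convex_cone {q. q = 0 \<or> q \<bullet> x > 0}"
        by (auto simp: convex_cone_iff inner_add_left)
    qed
    \<comment> \<open>A positive coefficient puts \<open>b\<close> into \<open>?K\<close>, against
      the minimality of \<open>T\<close>; a nonpositive one forces \<open>r = 0\<close>, which makes
      \<open>u\<close> a multiple of \<open>b\<close>.\<close>
    show False
    proof (cases "c - a - a' > 0")
      case True
      have "inverse (c - a - a') *\<^sub>R (r + r') \<in> ?K"
        using rr'K True by (intro convex_cone_hull_mul) simp_all
      then have "b \<in> ?K" using True by (simp flip: eq)
      then have "T \<subseteq> ?K" using hull_inc[of _ "T - {b}" convex_cone] by blast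
      then have "convex_cone hull T \<subseteq> ?K"
        by (simp add: hull_minimal convex_cone_convex_cone_hull)
      then have "?Q (T - {b})" using T by blast
      then have "card T \<le> card (T - {b})" using min by blast
      moreover have "finite T" using T finite_pos finite_subset by blast
      ultimately show False using b by (metis card_Diff1_less leD)
    next
      case False
      then have "(r + r') \<bullet> x \<le> 0"
        using bx by (simp flip: eq add: mult_nonpos_nonneg)
      moreover have "r = 0 \<or> r \<bullet> x > 0" "r' = 0 \<or> r' \<bullet> x > 0"
        using K_pos ar(3) ar'(3) by blast+
      ultimately have "r = 0" by (auto simp: inner_add_left)
      then have "u = a *\<^sub>R b" using ar by simp
      then show False using pos_multiple bpos u by blast
    qed
  qed
  then show ?thesis using T unfolding simple_roots_def by blast
qed

text \<open>Simple reflections carry \<open>v\<close>, up to sign, to a simple root; conjugating the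
  reflection in that root back gives the required word.\<close>

lemma reflection_simple_word:
  assumes T: "simple_roots T" and v: "v \<in> \<Phi>"
  obtains ts where "set ts \<subseteq> T" "reflection v = word ts"
proof -
  have TP: "T \<subseteq> pos" "pos \<subseteq> convex_cone hull T"
    and perm: "\<And>t u. t \<in> T \<Longrightarrow> u \<in> pos \<Longrightarrow> u \<noteq> t \<Longrightarrow> reflection t u \<in> pos"
    using T by (auto simp: simple_roots_def)
  \<comment> \<open>A root of least height in the orbit of v under simple reflections is itself simple.\<close>
  define X where "X = {u \<in> pos. \<exists>ts. set ts \<subseteq> T \<and> (u = word ts v \<or> u = - word ts v)}"
  have "v \<in> X \<or> - v \<in> X"
    using root_not_pos[OF v] by (auto simp: X_def intro!: exI[of _ "[]"])
  moreover have "finite X" using finite_pos by (simp add: X_def)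
  ultimately obtain u where u: "u \<in> X" and min: "\<And>y. y \<in> X \<Longrightarrow> u \<bullet> x \<le> y \<bullet> x"
    using ex_min_if_finite[of "(\<lambda>y. y \<bullet> x) ` X"] by (fastforce simp: not_less)
  then obtain ts where ts: "set ts \<subseteq> T" "u = word ts v \<or> u = - word ts v"
    by (auto simp: X_def)
  have upos: "u \<in> pos" using u by (simp add: X_def)
  \<comment> \<open>Otherwise \<open>u\<close> would pair nonpositively with the whole cone, which
    contains \<open>u\<close> itself.\<close>
  have "\<exists>t\<in>T. u \<bullet> t > 0"
  proof (rule ccontr)
    assume "\<not> ?thesis"
    then have "convex_cone hull T \<subseteq> {y. u \<bullet> y \<le> 0}"
      by (intro hull_minimal convex_cone_halfspace_le) (auto simp: not_less)
    then have "u \<bullet> u \<le> 0" using upos TP by blast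
    then have "u = 0" by (metis inner_gt_zero_iff not_less)
    then show False using upos by (simp add: pos_def)
  qed
  then obtain t where t: "t \<in> T" "u \<bullet> t > 0" by blast
  \<comment> \<open>Otherwise reflecting in \<open>t\<close> subtracts a positive multiple of
    \<open>t\<close> and gives an element of \<open>X\<close> of smaller height.\<close>
  have "u = t"
  proof (rule ccontr)
    assume "u \<noteq> t"
    then have "reflection t u \<in> pos" using perm t upos by blast
    moreover have "reflection t u = word (t # ts) v \<or> reflection t u = - word (t # ts) v"
      using ts(2) by (auto simp: linear_neg[OF linear_reflection])
    ultimately have "reflection t u \<in> X" using ts(1) t(1) unfolding X_def
      by (metis (mono_tags, lifting) insert_subset list.simps(15) mem_Collect_eq)
    then have "u \<bullet> x \<le> reflection t u \<bullet> x" by (rule min)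
    moreover have "t \<bullet> x > 0" using t TP by (auto simp: pos_def)
    moreover have "t \<bullet> t > 0" using t(2) by auto
    ultimately show False
      using t(2)
      by (simp add: reflection_def inner_diff_left mult_le_0_iff zero_le_divide_iff
          divide_le_0_iff not_less)
  qed
  \<comment> \<open>Opposite vectors have the same reflection, so the sign left open in
    \<open>X\<close> disappears here.\<close>
  then have rt: "reflection (word ts v) = reflection t"
    using ts(2) by (auto simp: reflection_def fun_eq_iff)
  have "reflection v = word (rev ts) \<circ> reflection t \<circ> word ts"
  proof
    fix y
    have "(word (rev ts) \<circ> reflection t \<circ> word ts) y = word (rev ts) (word ts (reflection v y))"
      by (simp add: rt reflection_conjugate[OF orthogonal_transformation_word])
    then show "reflection v y = (word (rev ts) \<circ> reflection t \<circ> word ts) y"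
      by (simp add: word_rev)
  qed
  then have "reflection v = word (rev ts @ t # ts)" by (simp add: word_append comp_assoc)
  then show thesis using that[of "rev ts @ t # ts"] ts(1) t(1) by simp
qed

section \<open>Words in simple reflections and their lengths\<close>

lemma word_simple_word:
  assumes T: "simple_roots T" and "set vs \<subseteq> \<Phi>"
  obtains ts where "set ts \<subseteq> T" "word vs = word ts"
proof -
  have "\<exists>ts. set ts \<subseteq> T \<and> word vs = word ts"
    using assms(2)
  proof (induction vs)
    case Nil
    show ?case by (intro exI[of _ "[]"]) simp
  next
    case (Cons v vs)
    then obtain ts where ts: "set ts \<subseteq> T" "word vs = word ts" by auto
    from Cons.prems obtain us where "set us \<subseteq> T" "reflection v = word us"
      using reflection_simple_word[OF T, of v] by auto
    with ts show ?case by (intro exI[of _ "us @ ts"]) (simp add: word_append)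
  qed
  then show thesis using that by blast
qed

text \<open>The exchange condition. Applying the letters from the right, the positive root
  \<open>a\<close> turns negative at some letter \<open>t\<close>. A simple reflection makes no
  positive root negative except its own, so the image of \<open>a\<close> just before is
  \<open>t\<close>, and the conjugation rule cancels this letter against the reflection in
  \<open>a\<close>.\<close>

lemma exchange:
  assumes T: "simple_roots T" and "set ts \<subseteq> T" "a \<in> T" "word ts a \<notin> pos"
  shows "\<exists>us. set us \<subseteq> T \<and> length ts = Suc (length us) \<and> word ts \<circ> reflection a = word us"
  using assms(2-4)
proof (induction ts)
  case Nil
  then show ?case using T by (auto simp: simple_roots_def)
next
  case (Cons t ts)
  show ?case
  proof (cases "word ts a \<in> pos")
    case True
    then have "word ts a = t"
      using Cons.prems T by (auto simp: simple_roots_def)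
    then have "reflection t (word ts y) = word ts (reflection a y)" for y
      by (simp add: reflection_conjugate[OF orthogonal_transformation_word])
    then have "word (t # ts) \<circ> reflection a = word ts" by (auto simp: fun_eq_iff)
    then show ?thesis using Cons.prems by (metis insert_subset length_Cons list.simps(15))
  next
    case False
    then obtain us where "set us \<subseteq> T" "length ts = Suc (length us)"
      "word ts \<circ> reflection a = word us"
      using Cons.IH Cons.prems(1,2) by (metis insert_subset list.simps(15))
    then show ?thesis using Cons.prems
      by (intro exI[of _ "t # us"]) (auto simp: fun_eq_iff)
  qed
qed

text \<open>Let \<open>a\<close> be the last letter of a shortest simple word for \<open>w\<close>.
  As \<open>w\<close> is orthogonal and fixes \<open>x\<close>, the root \<open>w a\<close> stays
  positive, so the word without \<open>a\<close> makes \<open>a\<close> negative. The exchange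
  condition then gives a word for \<open>w\<close> that is two letters shorter.\<close>

lemma stabiliser_trivial:
  assumes "w \<in> reflection_group \<Phi>" "w x = x"
  shows "w = id"
proof -
  obtain T where T: "simple_roots T" using simple_roots_exist by blast
  obtain vs where vs: "set vs \<subseteq> \<Phi>" "w = word vs"
    using reflection_group_imp_word[OF assms(1)] .
  let ?Q = "\<lambda>ts. set ts \<subseteq> T \<and> w = word ts"
  obtain ts0 where "?Q ts0" using word_simple_word[OF T vs(1)] vs(2) by metis
  then obtain ts where ts: "?Q ts" and min: "\<And>us. ?Q us \<Longrightarrow> length ts \<le> length us"
    using ex_has_least_nat[of ?Q ts0 length] by blast
  show ?thesis
  proof (cases ts rule: rev_cases)
    case Nil
    then show ?thesis using ts by simp
  next
    case (snoc us a)
    have a: "a \<in> pos" "a \<in> T" "set us \<subseteq> T"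
      using ts snoc T by (auto simp: simple_roots_def)
    have "w a \<bullet> x = w a \<bullet> w x" using assms(2) by simp
    also have "\<dots> = a \<bullet> x"
      using orthogonal_transformation_reflection_group[OF assms(1)]
      by (simp add: orthogonal_transformation_def)
    finally have "w a \<bullet> x > 0" using a by (simp add: pos_def)
    moreover have "w a = - word us a"
      using ts snoc orthogonal_transformation_word[of us]
      by (simp add: word_append linear_neg orthogonal_transformation_def)
    ultimately have "word us a \<notin> pos" by (simp add: pos_def)
    then obtain us' where "set us' \<subseteq> T" "length us = Suc (length us')"
      "word us \<circ> reflection a = word us'"
      using exchange[OF T a(3,2)] by blast
    then have "length ts \<le> length us'" using ts snoc by (intro min) (simp add: word_append)
    then show ?thesis using snoc \<open>length us = Suc (length us')\<close> by simp
  qed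
qed

end

section \<open>Orbits and invariants\<close>

text \<open>Each letter subtracts a multiple of a root. This controls group elements off the span of
  the roots, which may be a proper subspace.\<close>

lemma word_diff_in_span: "set ts \<subseteq> \<Phi> \<Longrightarrow> word ts u - u \<in> span \<Phi>"
proof (induction ts)
  case Nil
  then show ?case by (simp add: span_zero)
next
  case (Cons t ts)
  have "word (t # ts) u - u = (word ts u - u) - (2 * ((word ts u \<bullet> t) / (t \<bullet> t))) *\<^sub>R t"
    by (simp add: reflection_def)
  moreover have "word ts u - u \<in> span \<Phi>" "t \<in> span \<Phi>" using Cons by (auto simp: span_base)
  ultimately show ?case by (simp only: span_diff span_scale)
qed

text \<open>Restriction embeds the group into the self-maps of the finite set \<Phi>. If
  \<open>v\<close> and \<open>w\<close> agree on \<Phi>, then \<open>v u - w u\<close> lies in the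
  span of \<Phi> and is orthogonal to every root, each root being \<open>v b = w b\<close> for some
  root \<open>b\<close>; so it vanishes.\<close>

lemma finite_reflection_group:
  assumes "root_system \<Phi>"
  shows "finite (reflection_group \<Phi>)"
proof -
  let ?W = "reflection_group \<Phi>"
  have fin: "finite \<Phi>" using assms by (simp add: root_system_def)
  have maps: "w ` \<Phi> \<subseteq> \<Phi>" if "w \<in> ?W" for w
    using that word_root[OF assms] by (metis image_subsetI reflection_group_imp_word)
  have "inj_on (\<lambda>w. restrict w \<Phi>) ?W"
  proof
    fix v w assume v: "v \<in> ?W" and w: "w \<in> ?W" and eq: "restrict v \<Phi> = restrict w \<Phi>"
    have ov: "orthogonal_transformation v" and ow: "orthogonal_transformation w"
      using v w orthogonal_transformation_reflection_group by auto
    show "v = w"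
    proof
      fix u
      have "v u - u \<in> span \<Phi>" "w u - u \<in> span \<Phi>"
        using v w by (auto elim!: reflection_group_imp_word intro: word_diff_in_span)
      then have "(v u - u) - (w u - u) \<in> span \<Phi>" by (rule span_diff)
      then have "v u - w u \<in> span \<Phi>" by simp
      moreover have "orthogonal (v u - w u) a" if a: "a \<in> \<Phi>" for a
      proof -
        have "inj_on v \<Phi>" using orthogonal_transformation_inj[OF ov] by (rule inj_on_subset) simp
        then have "v ` \<Phi> = \<Phi>" by (rule endo_inj_surj[OF fin maps[OF v]])
        then obtain b where b: "b \<in> \<Phi>" "a = v b" using a by blast
        then have "a = w b" using eq by (metis restrict_apply')
        then have "w u \<bullet> a = u \<bullet> b" "v u \<bullet> a = u \<bullet> b"
          using b ov ow unfolding orthogonal_transformation_def by metis+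
        then show ?thesis by (simp add: orthogonal_def inner_diff_left)
      qed
      ultimately have "orthogonal (v u - w u) (v u - w u)" by (rule orthogonal_to_span)
      then show "v u = w u" by (simp add: orthogonal_self)
    qed
  qed
  moreover have "(\<lambda>w. restrict w \<Phi>) ` ?W \<subseteq> (\<Pi>\<^sub>E a\<in>\<Phi>. \<Phi>)"
    using maps by fastforce
  ultimately show ?thesis
    using finite_PiE[OF fin, of "\<lambda>_. \<Phi>"] fin by (meson finite_imageD finite_subset)
qed

lemma real_polynomial_function_norm_diff_power2:
  fixes a :: "'a::euclidean_space"
  shows "real_polynomial_function (\<lambda>u. (norm (u - a))\<^sup>2)"
proof -
  have "(norm (u - a))\<^sup>2 = (\<Sum>b\<in>Basis. (u \<bullet> b - a \<bullet> b)\<^sup>2)" for u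
    by (subst power2_norm_eq_inner, subst euclidean_inner)
      (simp add: inner_diff_left power2_eq_square)
  moreover have "real_polynomial_function (\<lambda>u. \<Sum>b\<in>Basis. (u \<bullet> b - a \<bullet> b)\<^sup>2)"
    by (intro real_polynomial_function_sum real_polynomial_function_power
        real_polynomial_function_diff real_polynomial_function.intros(1,2)
        bounded_linear_inner_left finite_Basis)
  ultimately show ?thesis by simp
qed

lemma invariants_separate_orbits:
  fixes \<Phi> :: "'a::euclidean_space set"
  assumes "root_system \<Phi>"
    and eq: "\<And>f. real_polynomial_function f \<Longrightarrow> invariant_under (reflection_group \<Phi>) f \<Longrightarrow> f y = f z"
  shows "\<exists>w\<in>reflection_group \<Phi>. z = w y"
proof -
  let ?W = "reflection_group \<Phi>"
  define X where "X = (\<lambda>w. w y) ` ?W"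
  \<comment> \<open>An invariant polynomial whose zero set is exactly the orbit of y.\<close>
  define f where "f u = (\<Prod>a\<in>X. (norm (u - a))\<^sup>2)" for u
  have fin: "finite X" using finite_reflection_group[OF assms(1)] by (simp add: X_def)
  have f0: "f u = 0 \<longleftrightarrow> u \<in> X" for u using fin by (auto simp: f_def)
  have "real_polynomial_function f"
    unfolding f_def using fin real_polynomial_function_norm_diff_power2
    by (intro real_polynomial_function_prod)
  \<comment> \<open>The isometry \<open>g\<close> permutes the finite orbit, so it only reorders the
    factors.\<close>
  moreover have "f (g u) = f u" if g: "g \<in> ?W" for g u
  proof -
    have og: "orthogonal_transformation g" using g by (rule orthogonal_transformation_reflection_group)
    have inj: "inj_on g X" using orthogonal_transformation_inj[OF og] by (rule inj_on_subset) simp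
    have "g \<circ> w \<in> ?W" if "w \<in> ?W" for w
      using subgroup.m_closed[OF subgroup_reflection_group g that] by (simp add: GL_def)
    then have "(g \<circ> w) y \<in> X" if "w \<in> ?W" for w using that unfolding X_def by blast
    then have "g ` X \<subseteq> X" by (auto simp: X_def)
    then have "g ` X = X" by (rule endo_inj_surj[OF fin _ inj])
    then have "f (g u) = (\<Prod>a\<in>g ` X. (norm (g u - a))\<^sup>2)" by (simp add: f_def)
    also have "\<dots> = (\<Prod>a\<in>X. (norm (g u - g a))\<^sup>2)" using inj by (simp add: prod.reindex)
    also have "\<dots> = f u"
      using og by (simp add: f_def orthogonal_transformation flip: linear_diff)
    finally show ?thesis .
  qed
  then have "invariant_under ?W f"
    using subgroup.m_inv_closed[OF subgroup_reflection_group]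
    by (fastforce simp: invariant_under_def act_def)
  ultimately have "f y = f z" by (rule eq)
  moreover have "y \<in> X"
    using subgroup.one_closed[OF subgroup_reflection_group, of \<Phi>]
    by (auto simp: X_def GL_def intro: rev_image_eqI)
  ultimately have "z \<in> X" using f0 by metis
  then show ?thesis by (auto simp: X_def)
qed

text \<open>An element of the algebra is a polynomial expression in members of \<open>S\<close>,
  hence determined by their values.\<close>

lemma generated_algebra_cong:
  "f \<in> generated_algebra S \<Longrightarrow> (\<And>g. g \<in> S \<Longrightarrow> g y = g z) \<Longrightarrow> f y = f z"
  by (induction rule: generated_algebra.induct) auto

section \<open>Basic invariants near a regular point\<close>

lemma basic_invariants_continuous:
  fixes \<eta> :: "nat \<Rightarrow> 'a::euclidean_space \<Rightarrow> real"
  assumes "basic_invariants W \<eta> deg" "i \<in> {1..DIM('a)}"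
  shows "continuous_on S (\<eta> i)"
  using assms
  by (auto simp: basic_invariants_def form_def continuous_on_eq_continuous_within
      intro!: continuous_at_imp_continuous_within continuous_real_polymonial_function)

lemma basic_invariants_inj_near_regular_point:
  fixes \<Phi> :: "'a::euclidean_space set"
  assumes rs: "root_system \<Phi>" and bi: "basic_invariants (reflection_group \<Phi>) \<eta> deg"
    and p: "p \<notin> hyperplane_union \<Phi>"
  shows "\<exists>r>0. \<forall>y\<in>ball p r. \<forall>z\<in>ball p r. (\<forall>i\<in>{1..DIM('a)}. \<eta> i y = \<eta> i z) \<longrightarrow> y = z"
proof -
  interpret regular_point \<Phi> p
    using rs p by unfold_locales (auto simp: hyperplane_union_def inner_commute)
  let ?W = "reflection_group \<Phi>"
  \<comment> \<open>Half the least distance by which a nonidentity element moves \<open>p\<close>,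
    positive because the stabiliser is trivial; the entry 1 keeps \<open>D\<close> nonempty for the
    trivial group.\<close>
  define D where "D = insert 1 ((\<lambda>w. dist (w p) p / 2) ` (?W - {id}))"
  have fin: "finite D" using finite_reflection_group[OF rs] by (simp add: D_def)
  have "\<forall>r\<in>D. r > 0" using stabiliser_trivial by (auto simp: D_def)
  then have "Min D > 0" using fin by (simp add: D_def)
  moreover have "y = z" if y: "y \<in> ball p (Min D)" and z: "z \<in> ball p (Min D)"
    and eq: "\<forall>i\<in>{1..DIM('a)}. \<eta> i y = \<eta> i z" for y z
  proof -
    have "f y = f z" if "real_polynomial_function f" "invariant_under ?W f" for f
    proof (rule generated_algebra_cong[of f _ y z])
      show "f \<in> generated_algebra (\<eta> ` {1..DIM('a)})"
        using bi that by (simp add: basic_invariants_def)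
    qed (use eq in auto)
    then obtain w where w: "w \<in> ?W" "z = w y" using invariants_separate_orbits[OF rs] by blast
    have "w = id"
    proof (rule ccontr)
      assume "w \<noteq> id"
      then have "Min D \<le> dist (w p) p / 2" using w fin by (intro Min_le) (auto simp: D_def)
      \<comment> \<open>Since \<open>w\<close> is an isometry, \<open>p\<close> would be moved by
        less than twice the radius.\<close>
      moreover have "dist (w p) p \<le> dist (w p) (w y) + dist z p"
        using w by (simp add: dist_triangle)
      moreover have "dist (w p) (w y) = dist p y"
        using orthogonal_transformation_reflection_group[OF w(1)]
        by (simp add: dist_norm orthogonal_transformation flip: linear_diff)
      ultimately show False using y z by (simp add: dist_commute)
    qed
    then show ?thesis using w by simp
  qed
  ultimately show ?thesis by blast
qed

lemma basic_invariants_open_near_regular_point: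
  fixes \<Phi> :: "'a::euclidean_space set"
  assumes rs: "root_system \<Phi>" and bi: "basic_invariants (reflection_group \<Phi>) \<eta> deg"
    and p: "p \<notin> hyperplane_union \<Phi>"
  shows "\<exists>e>0. \<forall>c. \<bar>c\<bar> < e \<longrightarrow>
    (\<exists>y. (\<forall>i\<in>{1..DIM('a) - 1}. \<eta> i y = \<eta> i p) \<and> \<eta> (DIM('a)) y = \<eta> (DIM('a)) p + c)"
proof -
  let ?n = "DIM('a)"
  obtain r where r: "r > 0" and
    inj: "\<And>y z. y \<in> ball p r \<Longrightarrow> z \<in> ball p r \<Longrightarrow> (\<forall>i\<in>{1..?n}. \<eta> i y = \<eta> i z) \<Longrightarrow> y = z"
    using basic_invariants_inj_near_regular_point[OF assms] by blast
  \<comment> \<open>Labelling the basis by the indices of the invariants turns them into the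
    coordinates of a self-map \<open>G\<close> of the space, as invariance of domain
    requires.\<close>
  obtain k where k: "bij_betw k (Basis :: 'a set) {1..?n}"
    using finite_same_card_bij[of "Basis :: 'a set" "{1..?n}"] by auto
  have k_in: "k b \<in> {1..?n}" if "b \<in> Basis" for b using k that by (auto simp: bij_betw_def)
  have k_ex: "\<exists>b\<in>Basis. k b = i" if "i \<in> {1..?n}" for i
    using k that by (metis bij_betw_iff_bijections)
  define G where "G y = (\<Sum>b\<in>Basis. \<eta> (k b) y *\<^sub>R b)" for y :: 'a
  have G: "G y \<bullet> b = \<eta> (k b) y" if "b \<in> Basis" for y b using that by (simp add: G_def)
  have "open (G ` ball p r)"
  proof (rule invariance_of_domain)
    show "continuous_on (ball p r) G"
      unfolding G_def using k_in
      by (intro continuous_on_sum continuous_on_scaleR basic_invariants_continuous[OF bi]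
          continuous_on_const) auto
    show "inj_on G (ball p r)"
    proof
      fix y z assume "y \<in> ball p r" "z \<in> ball p r" "G y = G z"
      then show "y = z" using inj G k_ex by metis
    qed
  qed simp
  moreover have "G p \<in> G ` ball p r" using r by simp
  ultimately obtain e where e: "e > 0" "ball (G p) e \<subseteq> G ` ball p r"
    by (meson open_contains_ball)
  obtain m where m: "m \<in> Basis" "k m = ?n" using k_ex[of ?n] by (auto simp: DIM_positive Suc_leI)
  have "\<exists>y. (\<forall>i\<in>{1..?n - 1}. \<eta> i y = \<eta> i p) \<and> \<eta> ?n y = \<eta> ?n p + c" if "\<bar>c\<bar> < e" for c
  proof -
    \<comment> \<open>Moving along the basis vector labelled by the last index changes the last
      invariant alone.\<close>
    have "G p + c *\<^sub>R m \<in> ball (G p) e" using that m by (simp add: dist_norm)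
    then obtain y where y: "G y = G p + c *\<^sub>R m" using e by (metis imageE subsetD)
    have yb: "\<eta> (k b) y = \<eta> (k b) p + c * (m \<bullet> b)" if "b \<in> Basis" for b
      using arg_cong[OF y, of "\<lambda>u. u \<bullet> b"] that by (simp add: G inner_add_left)
    have "\<eta> ?n y = \<eta> ?n p + c" using yb[of m] m by simp
    moreover have "\<eta> i y = \<eta> i p" if "i \<in> {1..?n - 1}" for i
    proof -
      have "i \<in> {1..?n}" using that by auto
      then obtain b where b: "b \<in> Basis" "k b = i" using k_ex by blast
      then have "b \<noteq> m" using m that by auto
      then show ?thesis using yb[of b] b m by (simp add: inner_not_same_Basis)
    qed
    ultimately show ?thesis by blast
  qed
  then show ?thesis using e(1) by blast
qed

section \<open>Invariant forms of small degree\<close>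

lemma generated_algebra_sum:
  "finite I \<Longrightarrow> (\<And>i. i \<in> I \<Longrightarrow> f i \<in> generated_algebra S) \<Longrightarrow>
    (\<lambda>x. \<Sum>i\<in>I. f i x) \<in> generated_algebra S"
  by (induction I rule: finite_induct)
    (auto intro: generated_algebra.const generated_algebra.add)

text \<open>A module over \<open>generated_algebra S\<close>, but in general not an algebra, since
  products of its elements involve the square of \<open>h\<close>.\<close>

definition affine_over :: "('a \<Rightarrow> real) set \<Rightarrow> ('a \<Rightarrow> real) \<Rightarrow> ('a \<Rightarrow> real) set" where
  "affine_over S h = {f. \<exists>A\<in>generated_algebra S. \<exists>B\<in>generated_algebra S. f = (\<lambda>x. A x + B x * h x)}"

lemma affine_overI:
  "A \<in> generated_algebra S \<Longrightarrow> B \<in> generated_algebra S \<Longrightarrow> (\<And>x. f x = A x + B x * h x) \<Longrightarrow>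
    f \<in> affine_over S h"
  by (auto simp: affine_over_def)

lemma generated_algebra_subset_affine_over: "generated_algebra S \<subseteq> affine_over S h"
  using generated_algebra.const[of 0 S] by (force intro: affine_overI)

lemma affine_over_add:
  assumes "f \<in> affine_over S h" "g \<in> affine_over S h"
  shows "(\<lambda>x. f x + g x) \<in> affine_over S h"
proof -
  obtain A B A' B' where
    "A \<in> generated_algebra S" "B \<in> generated_algebra S" "f = (\<lambda>x. A x + B x * h x)"
    "A' \<in> generated_algebra S" "B' \<in> generated_algebra S" "g = (\<lambda>x. A' x + B' x * h x)"
    using assms by (auto simp: affine_over_def)
  then show ?thesis
    by (intro affine_overI[of "\<lambda>x. A x + A' x" _ "\<lambda>x. B x + B' x"])
      (auto intro: generated_algebra.add simp: algebra_simps)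
qed

lemma affine_over_mult:
  assumes "f \<in> generated_algebra S" "g \<in> affine_over S h"
  shows "(\<lambda>x. f x * g x) \<in> affine_over S h"
proof -
  obtain A B where
    "A \<in> generated_algebra S" "B \<in> generated_algebra S" "g = (\<lambda>x. A x + B x * h x)"
    using assms by (auto simp: affine_over_def)
  with assms(1) show ?thesis
    by (intro affine_overI[of "\<lambda>x. f x * A x" _ "\<lambda>x. f x * B x"])
      (auto intro: generated_algebra.mult simp: algebra_simps)
qed

lemma affine_over_sum:
  "finite I \<Longrightarrow> (\<And>i. i \<in> I \<Longrightarrow> f i \<in> affine_over S h) \<Longrightarrow> (\<lambda>x. \<Sum>i\<in>I. f i x) \<in> affine_over S h"
proof (induction I rule: finite_induct)
  case empty
  then show ?case
    using generated_algebra_subset_affine_over[of S h] generated_algebra.const[of 0 S] by auto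
qed (auto intro: affine_over_add)

text \<open>By degree, \<open>h\<close> cannot enter a component of degree below \<open>D\<close>,
  nor its square one of degree below \<open>2 * D\<close>. The induction follows all homogeneous
  components because the subexpressions building \<open>F\<close> need not be forms.\<close>

lemma form_affine_in_top_generator:
  fixes S :: "('a::real_normed_vector \<Rightarrow> real) set"
  assumes F: "F \<in> generated_algebra (insert h S)"
    and S: "\<And>f. f \<in> S \<Longrightarrow> \<exists>k. form k f" and h: "form D h" "D \<ge> 1"
    and "form k F" "k < 2 * D"
  shows "F \<in> affine_over S h"
proof -
  let ?A = "generated_algebra S"
  \<comment> \<open>The bound at \<open>D\<close> serves the product case, where it frees one of the
    two factors from \<open>h\<close>.\<close>
  define R where "R k f \<longleftrightarrow> (k < D \<longrightarrow> f \<in> ?A) \<and> (k < 2 * D \<longrightarrow> f \<in> affine_over S h)" for k f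
  have R_A: "R k f" if "f \<in> ?A" for k f
    using that generated_algebra_subset_affine_over[of S h] by (auto simp: R_def)
  have R0: "R k (\<lambda>x. 0)" for k by (intro R_A generated_algebra.const)
  \<comment> \<open>The coefficients of f (t x), as a polynomial in t, are the homogeneous components of f.\<close>
  have "\<exists>c. (\<forall>x t. F (t *\<^sub>R x) = poly (c x) t) \<and> (\<forall>k. R k (\<lambda>x. coeff (c x) k))"
    using F
  proof (induction rule: generated_algebra.induct)
    case (const a)
    have "R k (\<lambda>x. coeff [:a:] k)" for k by (intro R_A generated_algebra.const)
    then show ?case by (intro exI[of _ "\<lambda>x. [:a:]"]) simp
  next
    case (gen f)
    \<comment> \<open>The zero function is a form of every degree, so the degree used for
      \<open>h\<close> is fixed to be \<open>D\<close>.\<close>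
    obtain j where j: "form j f" "f = h \<Longrightarrow> j = D" "f \<noteq> h \<Longrightarrow> f \<in> S"
      using gen S h by (cases "f = h") auto
    have "R j f"
    proof (cases "f = h")
      case True
      have "h \<in> affine_over S h"
        by (rule affine_overI[of "\<lambda>x. 0" _ "\<lambda>x. 1"]) (auto intro: generated_algebra.const)
      with True j show ?thesis by (simp add: R_def)
    next
      case False
      with j show ?thesis by (intro R_A generated_algebra.gen) simp
    qed
    then have "R k (\<lambda>x. coeff (monom (f x) j) k)" for k
      using R0 by (cases "j = k") simp_all
    moreover have "f (t *\<^sub>R x) = poly (monom (f x) j) t" for x t
      using j(1) by (simp add: form_def poly_monom)
    ultimately show ?case by (intro exI[of _ "\<lambda>x. monom (f x) j"]) simp
  next
    case (add f g)
    then obtain c c' where "\<forall>x t. f (t *\<^sub>R x) = poly (c x) t" "\<And>k. R k (\<lambda>x. coeff (c x) k)"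
      "\<forall>x t. g (t *\<^sub>R x) = poly (c' x) t" "\<And>k. R k (\<lambda>x. coeff (c' x) k)" by blast
    then show ?case
      by (intro exI[of _ "\<lambda>x. c x + c' x"])
        (auto simp: R_def intro: generated_algebra.add affine_over_add)
  next
    case (mult f g)
    then obtain c c' where c: "\<forall>x t. f (t *\<^sub>R x) = poly (c x) t" "\<And>k. R k (\<lambda>x. coeff (c x) k)"
      "\<forall>x t. g (t *\<^sub>R x) = poly (c' x) t" "\<And>k. R k (\<lambda>x. coeff (c' x) k)" by blast
    have "R k (\<lambda>x. coeff (c x * c' x) k)" for k
      unfolding R_def coeff_mult
    proof (intro conjI impI)
      assume "k < D"
      then show "(\<lambda>x. \<Sum>i\<le>k. coeff (c x) i * coeff (c' x) (k - i)) \<in> ?A"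
        using c(2,4) by (intro generated_algebra_sum generated_algebra.mult) (auto simp: R_def)
    next
      assume k: "k < 2 * D"
      show "(\<lambda>x. \<Sum>i\<le>k. coeff (c x) i * coeff (c' x) (k - i)) \<in> affine_over S h"
      proof (rule affine_over_sum)
        fix i assume i: "i \<in> {..k}"
        show "(\<lambda>x. coeff (c x) i * coeff (c' x) (k - i)) \<in> affine_over S h"
        \<comment> \<open>As \<open>i + (k - i) = k < 2 * D\<close>, one of the two indices is below
          \<open>D\<close>; that factor lies in \<open>?A\<close> and the other is affine in
          \<open>h\<close>.\<close>
        proof (cases "i < D")
          case True
          then show ?thesis using c(2)[of i] c(4)[of "k - i"] k
            by (intro affine_over_mult) (auto simp: R_def)
        next
          case False
          then have "(\<lambda>x. coeff (c' x) (k - i) * coeff (c x) i) \<in> affine_over S h"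
            using c(2)[of i] c(4)[of "k - i"] k i
            by (intro affine_over_mult) (auto simp: R_def)
          then show ?thesis by (simp add: mult.commute)
        qed
      qed simp
    qed
    then show ?case using c by (intro exI[of _ "\<lambda>x. c x * c' x"]) simp
  qed
  then obtain c where c: "\<And>x t. F (t *\<^sub>R x) = poly (c x) t" "\<And>k. R k (\<lambda>x. coeff (c x) k)" by blast
  \<comment> \<open>Real polynomials that agree at every point are equal, so a form has a single
    homogeneous component.\<close>
  have "c x = monom (F x) k" for x
    using assms(5) c(1)[of _ x]
    by (simp add: form_def poly_monom fun_eq_iff mult.commute flip: poly_eq_poly_eq_iff)
  then have "coeff (c x) k = F x" for x by simp
  then show ?thesis using c(2)[of k] assms(6) by (simp add: R_def)
qed

section \<open>Minimisation on common level sets of the lower invariants\<close>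

theorem theorem1p1:
  fixes \<Phi> :: "'a::euclidean_space set"
    and \<eta> :: "nat \<Rightarrow> 'a \<Rightarrow> real"
    and deg :: "nat \<Rightarrow> nat"
    and F :: "'a \<Rightarrow> real"
    and d :: nat
  assumes "root_system \<Phi>"
    and "basic_invariants (reflection_group \<Phi>) \<eta> deg"
    and "mono_on {1..DIM('a)} deg"
    and "(\<lambda>x. (norm x)\<^sup>2) \<in> generated_algebra (\<eta> ` {1..DIM('a) - 1})"
    and "form (2 * d) F"
    and "invariant_under (reflection_group \<Phi>) F"
    and "2 * d < 2 * deg (DIM('a))"
  shows "(\<forall>x. F x \<ge> 0) \<longleftrightarrow> (\<forall>x\<in>hyperplane_union \<Phi>. F x \<ge> 0)"
proof
  let ?n = "DIM('a)"
  let ?S = "\<eta> ` {1..?n - 1}"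
  assume H: "\<forall>x\<in>hyperplane_union \<Phi>. F x \<ge> 0"
  have n: "?n \<in> {1..?n}" by (simp add: DIM_positive Suc_leI)
  have "F \<in> affine_over ?S (\<eta> ?n)"
  proof (rule form_affine_in_top_generator)
    have "{1..?n} = insert ?n {1..?n - 1}" using n by auto
    then have "insert (\<eta> ?n) ?S = \<eta> ` {1..?n}" by (metis image_insert)
    then show "F \<in> generated_algebra (insert (\<eta> ?n) ?S)"
      using assms by (simp add: basic_invariants_def form_def)
    show "\<exists>k. form k f" if "f \<in> ?S" for f
      using that assms(2) by (fastforce simp: basic_invariants_def)
    show "form (deg ?n) (\<eta> ?n)" "1 \<le> deg ?n"
      using assms(2) n by (auto simp: basic_invariants_def)
  qed (use assms in auto)
  then obtain A B where A: "A \<in> generated_algebra ?S" and B: "B \<in> generated_algebra ?S"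
    and F: "F = (\<lambda>x. A x + B x * \<eta> ?n x)" by (auto simp: affine_over_def)
  show "\<forall>x. F x \<ge> 0"
  proof
    fix x
    define Y where "Y = {y. \<forall>i\<in>{1..?n - 1}. \<eta> i y = \<eta> i x}"
    have const: "f y = f x" if "y \<in> Y" "f \<in> generated_algebra ?S" for f y
      using that by (intro generated_algebra_cong[OF that(2)]) (auto simp: Y_def)
    have cont: "continuous_on UNIV (\<eta> i)" if "i \<in> {1..?n}" for i
      using basic_invariants_continuous[OF assms(2) that] .
    have "Y = (\<Inter>i\<in>{1..?n - 1}. {y. \<eta> i y = \<eta> i x})" by (auto simp: Y_def)
    moreover have "closed {y. \<eta> i y = \<eta> i x}" if "i \<in> {1..?n - 1}" for i
      using that by (intro closed_Collect_eq cont continuous_on_const) auto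
    ultimately have "closed Y" by auto
    \<comment> \<open>The squared norm belongs to the algebra of the lower invariants, so it is
      constant on \<open>Y\<close>.\<close>
    moreover have "Y \<subseteq> cball 0 (norm x)"
      using const[OF _ assms(4)] by (auto simp: power2_eq_iff_nonneg)
    then have "bounded Y" using bounded_cball bounded_subset by blast
    ultimately have "compact Y" by (simp add: compact_eq_bounded_closed)
    moreover have "x \<in> Y" by (simp add: Y_def)
    \<comment> \<open>The sign of \<open>B x\<close>, so that
      \<open>B x = \<bar>B x\<bar> * s\<close> and minimising \<open>s * \<eta> ?n\<close> minimises
      \<open>F\<close> on \<open>Y\<close>; the value 1 at zero keeps s^2 = 1.\<close>
    moreover define s :: real where "s = (if B x \<ge> 0 then 1 else -1)"
    moreover have "continuous_on Y (\<lambda>y. s * \<eta> ?n y)"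
      by (intro continuous_on_mult_left basic_invariants_continuous[OF assms(2) n])
    ultimately obtain p where p: "p \<in> Y" and min: "\<And>y. y \<in> Y \<Longrightarrow> s * \<eta> ?n p \<le> s * \<eta> ?n y"
      using continuous_attains_inf[of Y "\<lambda>y. s * \<eta> ?n y"] by blast
    have "p \<in> hyperplane_union \<Phi>"
    proof (rule ccontr)
      assume "p \<notin> hyperplane_union \<Phi>"
      then obtain e where "e > 0" and e: "\<And>c. \<bar>c\<bar> < e \<Longrightarrow>
          \<exists>y. (\<forall>i\<in>{1..?n - 1}. \<eta> i y = \<eta> i p) \<and> \<eta> ?n y = \<eta> ?n p + c"
        using basic_invariants_open_near_regular_point[OF assms(1,2)] by blast
      \<comment> \<open>This shift of the last invariant lowers \<open>s * \<eta> ?n\<close> by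
        \<open>e / 2\<close> without leaving \<open>Y\<close>, contradicting the choice of
        \<open>p\<close>.\<close>
      have "\<bar>- s * e / 2\<bar> < e" using \<open>e > 0\<close> by (simp add: s_def)
      then obtain y where y: "\<forall>i\<in>{1..?n - 1}. \<eta> i y = \<eta> i p" "\<eta> ?n y = \<eta> ?n p + - s * e / 2"
        using e by blast
      then have "y \<in> Y" using p by (simp add: Y_def)
      then have "s * \<eta> ?n p \<le> s * \<eta> ?n y" by (rule min)
      then show False using y(2) \<open>e > 0\<close> by (simp add: s_def split: if_splits)
    qed
    then have "0 \<le> F p" using H by blast
    also have "F p = A x + B x * \<eta> ?n p" using const[OF p A] const[OF p B] by (simp add: F)
    also have "\<dots> = A x + \<bar>B x\<bar> * (s * \<eta> ?n p)" by (simp add: s_def)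
    also have "\<dots> \<le> A x + \<bar>B x\<bar> * (s * \<eta> ?n x)"
      using min[of x] by (simp add: Y_def mult_left_mono)
    also have "\<dots> = F x" by (simp add: F s_def)
    finally show "F x \<ge> 0" .
  qed
qed simp

end
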